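(* For every $C>1$ there exists $k(C)\in\mathbb{N}$ such that the following holds: if for some $k\in\mathbb{N}$, $k\ge 2$, and every $n\in\mathbb{N}$ there exists an embedding $f_n:D_{n,k}\to\ell_1$ satisfying $$\forall u,v\in D_{n,k},\ u\neq v:\quad \|f_n(u)-f_n(v)\|_1\le d_{D_{n,k}}(u,v)< C\cdot\|f_n(u)-f_n(v)\|_s,$$ then $k\le k(C)$.
   Context: Diamond graphs of branching $k$: for any integer $k\ge 2$, $D_{0,k}$ is the graph consisting of two vertices joined by one edge. For $n\in\mathbb{N}$, if $D_{n-1,k}$ is already defined, $D_{n,k}$ is the graph obtained from $D_{n-1,k}$ by replacing each edge $uv$ of $D_{n-1,k}$ by a set of $k$ independent (i.e. internally vertex-disjoint) paths of length $2$ joining $u$ and $v$. The graph $D_{n,k}$ is endowed with the shortest path distance $d_{D_{n,k}}$, normalized so that each edge has length $2^{-n}$; expressions such as $u\in D_{n,k}$ refer to vertices. $\ell_1$ is the space of absolutely summable real sequences, $\|\cdot\|_1$ is its standard norm, and $\|\cdot\|_s$ is the summing norm on $\ell_1$: $\|(a_i)_{i=1}^\infty\|_s=\sup_{m}\left|\sum_{i=1}^m a_i\right|$. *)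

theory Defs
  imports
    "HOL-Analysis.Analysis"
    "Graph_Theory.Digraph_Component"
    "Graph_Theory.Shortest_Path"
begin

text \<open>
  \<open>Mid u v i\<close> is the midpoint of the \<open>i\<close>-th of the paths of length 2 that replace the edge \<open>uv\<close>.
\<close>

datatype dvertex = Src | Tgt | Mid dvertex dvertex nat

text \<open>
  Each edge is recorded here with one orientation, so that it is subdivided only once; the
  diamond graph itself is the symmetric closure.
\<close>

primrec diamond_oriented :: "nat \<Rightarrow> nat \<Rightarrow> dvertex pair_pre_digraph" where
  "diamond_oriented k 0 = \<lparr>pverts = {Src, Tgt}, parcs = {(Src, Tgt)}\<rparr>"
| "diamond_oriented k (Suc n) =
    \<lparr>pverts = pverts (diamond_oriented k n) \<union>
       (\<Union>(u, v)\<in>parcs (diamond_oriented k n). \<Union>i<k. {Mid u v i}),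
     parcs = (\<Union>(u, v)\<in>parcs (diamond_oriented k n). \<Union>i<k. {(u, Mid u v i), (Mid u v i, v)})\<rparr>"

definition diamond :: "nat \<Rightarrow> nat \<Rightarrow> dvertex pair_pre_digraph" where
  "diamond k n = mk_symmetric (with_proj (diamond_oriented k n))"

definition diamond_dist :: "nat \<Rightarrow> nat \<Rightarrow> dvertex \<Rightarrow> dvertex \<Rightarrow> real" where
  "diamond_dist k n u v =
     real_of_ereal (wf_digraph.\<mu> (with_proj (diamond k n)) (\<lambda>_. (1 / 2) ^ n) u v)"

definition ell1 :: "(nat \<Rightarrow> real) set" where
  "ell1 = {x. summable (\<lambda>i. \<bar>x i\<bar>)}"

definition ell1_norm :: "(nat \<Rightarrow> real) \<Rightarrow> real" where
  "ell1_norm x = (\<Sum>i. \<bar>x i\<bar>)"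

text \<open>
  Sequences are indexed from 0, so the nonempty initial sums are those over \<open>{..m}\<close>.
  The supremum is over a bounded set for elements of \<open>ell1\<close>, the only ones it is used for.
\<close>

definition summing_norm :: "(nat \<Rightarrow> real) \<Rightarrow> real" where
  "summing_norm x = (SUP m. \<bar>\<Sum>i\<le>m. x i\<bar>)"

lemma bdd_above_summing_norm:
  assumes "x \<in> ell1"
  shows "bdd_above (range (\<lambda>m. \<bar>\<Sum>i\<le>m. x i\<bar>))"
proof (rule bdd_aboveI2)
  fix m
  have "\<bar>\<Sum>i\<le>m. x i\<bar> \<le> (\<Sum>i\<le>m. \<bar>x i\<bar>)"
    by (rule sum_abs)
  also have "\<dots> \<le> (\<Sum>i. \<bar>x i\<bar>)"
    using assms by (intro sum_le_suminf) (auto simp: ell1_def)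
  finally show "\<bar>\<Sum>i\<le>m. x i\<bar> \<le> (\<Sum>i. \<bar>x i\<bar>)" .
qed

primrec dvertex_depth :: "dvertex \<Rightarrow> nat" where
  "dvertex_depth Src = 0"
| "dvertex_depth Tgt = 0"
| "dvertex_depth (Mid u v i) = Suc (max (dvertex_depth u) (dvertex_depth v))"

lemma depth_pverts_diamond_oriented:
  "(\<forall>w\<in>pverts (diamond_oriented k n). dvertex_depth w \<le> n) \<and>
   (\<forall>(u, v)\<in>parcs (diamond_oriented k n). max (dvertex_depth u) (dvertex_depth v) = n)"
  by (induction n) fastforce+

text \<open>The midpoints added at each step are new vertices.\<close>

lemma Mid_notin_diamond_oriented:
  assumes "(u, v) \<in> parcs (diamond_oriented k n)"
  shows "Mid u v i \<notin> pverts (diamond_oriented k n)"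
proof
  assume "Mid u v i \<in> pverts (diamond_oriented k n)"
  then have "dvertex_depth (Mid u v i) \<le> n"
    using depth_pverts_diamond_oriented by blast
  moreover have "max (dvertex_depth u) (dvertex_depth v) = n"
    using assms depth_pverts_diamond_oriented by blast
  ultimately show False by simp
qed

lemma diamond_oriented_wf:
  "\<forall>(u, v)\<in>parcs (diamond_oriented k n).
     u \<in> pverts (diamond_oriented k n) \<and> v \<in> pverts (diamond_oriented k n) \<and> u \<noteq> v"
proof (induction n)
  case (Suc n)
  then show ?case
    using Mid_notin_diamond_oriented[of _ _ k n] by fastforce
qed simp

lemma diamond_oriented_finite:
  "finite (pverts (diamond_oriented k n)) \<and> finite (parcs (diamond_oriented k n))"
  by (induction n) auto

lemma pair_digraph_diamond_oriented: "pair_digraph (diamond_oriented k n)"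
  using diamond_oriented_wf[of k n] diamond_oriented_finite[of k n]
  by unfold_locales auto

lemma pair_graph_diamond: "pair_graph (diamond k n)"
proof -
  interpret D: pair_digraph "diamond_oriented k n"
    by (rule pair_digraph_diamond_oriented)
  interpret S: pair_digraph "diamond k n"
    unfolding diamond_def by (rule D.digraph_mk_symmetric)
  show ?thesis
    by unfold_locales (simp add: diamond_def symmetric_mk_symmetric)
qed

lemma parcs_diamond:
  "parcs (diamond k n) = parcs (diamond_oriented k n) \<union> (parcs (diamond_oriented k n))\<inverse>"
  by (auto simp: diamond_def mk_symmetric_def)

lemma pverts_diamond: "pverts (diamond k n) = pverts (diamond_oriented k n)"
  by (simp add: diamond_def mk_symmetric_def)

lemma diamond_connected_aux:
  assumes "k \<ge> 1" "u \<in> pverts (diamond k n)"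
  shows "(Src, u) \<in> (parcs (diamond k n))\<^sup>*"
  using assms(2)
proof (induction n arbitrary: u)
  case 0
  then show ?case by (auto simp: parcs_diamond pverts_diamond)
next
  case (Suc n)
  let ?R = "parcs (diamond k (Suc n))"
  have arc: "(a, Mid a b i) \<in> ?R \<and> (Mid a b i, b) \<in> ?R \<and> (b, Mid a b i) \<in> ?R \<and> (Mid a b i, a) \<in> ?R"
    if "(a, b) \<in> parcs (diamond_oriented k n)" "i < k" for a b i
  proof -
    have "(a, Mid a b i) \<in> parcs (diamond_oriented k (Suc n))"
      "(Mid a b i, b) \<in> parcs (diamond_oriented k (Suc n))"
      using that by auto
    then show ?thesis unfolding parcs_diamond by blast
  qed
  have "parcs (diamond k n) \<subseteq> ?R\<^sup>*"
  proof (clarify)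
    fix a b assume "(a, b) \<in> parcs (diamond k n)"
    then consider "(a, b) \<in> parcs (diamond_oriented k n)" | "(b, a) \<in> parcs (diamond_oriented k n)"
      by (auto simp: parcs_diamond)
    then show "(a, b) \<in> ?R\<^sup>*"
      by cases (use arc[of _ _ 0] assms(1) in \<open>meson le_eq_less_or_eq less_le_trans zero_less_one
        r_into_rtrancl rtrancl_trans\<close>)+
  qed
  then have old: "(Src, w) \<in> ?R\<^sup>*" if "w \<in> pverts (diamond k n)" for w
    using Suc.IH[OF that] rtrancl_subset_rtrancl by blast
  from Suc.prems consider "u \<in> pverts (diamond k n)"
    | a b i where "(a, b) \<in> parcs (diamond_oriented k n)" "i < k" "u = Mid a b i"
    by (auto simp: pverts_diamond)
  then show ?case
  proof cases
    case 2
    then have "a \<in> pverts (diamond k n)"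
      using diamond_oriented_wf[of k n] by (auto simp: pverts_diamond)
    with 2 arc[OF 2(1,2)] old show ?thesis by (meson rtrancl.rtrancl_into_rtrancl)
  qed (rule old)
qed

text \<open>
  Between vertices, \<open>\<mu>\<close> is finite, so nothing is lost by \<open>real_of_ereal\<close> in \<open>diamond_dist\<close>.
\<close>

lemma diamond_mu_finite:
  assumes "k \<ge> 1" "u \<in> pverts (diamond k n)" "v \<in> pverts (diamond k n)"
  shows "\<bar>wf_digraph.\<mu> (with_proj (diamond k n)) (\<lambda>_. (1 / 2) ^ n) u v\<bar> \<noteq> \<infinity>"
proof -
  interpret D: pair_graph "diamond k n" by (rule pair_graph_diamond)
  have sym: "sym (parcs (diamond k n))"
    by (auto simp: parcs_diamond sym_def)
  have "(u, v) \<in> (parcs (diamond k n))\<^sup>*"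
    using diamond_connected_aux[OF assms(1)] assms(2,3) sym_rtrancl[OF sym]
    by (meson rtrancl_trans symD)
  then have "\<exists>p. D.awalk u p v"
  proof (induction rule: converse_rtrancl_induct)
    case base
    have "D.awalk v [] v" using assms(3) by (simp add: D.awalk_Nil_iff)
    then show ?case ..
  next
    case (step a b)
    then obtain p where "D.awalk b p v" by blast
    with step(1) have "D.awalk a ((a, b) # p) v"
      by (auto simp: D.awalk_Cons_iff)
    then show ?case ..
  qed
  then obtain p where p: "D.awalk u p v" by blast
  have "D.\<mu> (\<lambda>_. (1 / 2) ^ n) u v \<le> D.awalk_cost (\<lambda>_. (1 / 2) ^ n) p"
    by (rule D.min_cost_le_walk_cost[OF p])
  moreover have "0 \<le> D.\<mu> (\<lambda>_. (1 / 2) ^ n) u v"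
    unfolding D.\<mu>_def by (rule INF_greatest) (auto intro: D.pos_cost_pos_awalk_cost)
  ultimately show ?thesis by auto
qed

end

theory Submission
  imports Defs
begin

text \<open>
  The starting point is a compactness property of order intervals: if \<open>w \<in> ell1\<close>, then the
  sequences \<open>x\<close> with \<open>\<bar>x j\<bar> \<le> \<bar>w j\<bar>\<close> for all \<open>j\<close> form a totally bounded set for the summing norm,
  with covering numbers that depend only on \<open>ell1_norm w\<close>. Indeed the initial sums of \<open>x\<close> are
  \<open>1\<close>-Lipschitz in the variable \<open>\<Sum>i\<le>m. \<bar>w i\<bar>\<close>, so they form an equicontinuous family. The
  quantitative version \<open>card_separated_near_interval\<close> only needs \<open>x\<close> to lie nearly
  between \<open>0\<close> and \<open>w\<close>, in the sense that \<open>ell1_norm x + ell1_norm (w - x)\<close> hardly exceeds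
  \<open>ell1_norm w\<close>.

  Such a situation is found in every deep diamond graph. Call the quotient of
  \<open>ell1_norm (f v - f u)\<close> by \<open>d u v\<close> the stretch of the pair \<open>u, v\<close>. The largest stretch among
  the pairs that are edges of the graph of level \<open>m\<close> lies in \<open>[0, 1]\<close> for all \<open>m \<le> n\<close>, so for
  some \<open>m < n\<close> it grows by at most \<open>1 / n\<close> from level \<open>m\<close> to level \<open>m + 1\<close>. Let \<open>u v\<close> be an edge
  of maximal stretch on that level \<open>m\<close>, and consider \<open>w = f v - f u\<close> and the vectors
  \<open>x\<^sub>i = f (Mid u v i) - f u\<close>. No half of the edge is stretched much more than the edge itself,
  so each \<open>x\<^sub>i\<close> lies nearly between \<open>0\<close> and \<open>w\<close>. The \<open>k\<close> midpoints are at distance \<open>d u v\<close> from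
  each other, so the \<open>x\<^sub>i\<close> are separated in the summing norm by at least \<open>d u v / C\<close>. Taking
  \<open>n \<ge> 5 * C\<close> bounds \<open>k\<close> in terms of \<open>C\<close> alone (\<open>diamond_branching_bound\<close>).
\<close>

section \<open>The norms on absolutely summable sequences\<close>

lemma ell1_diff: "x \<in> ell1 \<Longrightarrow> y \<in> ell1 \<Longrightarrow> x - y \<in> ell1"
  unfolding ell1_def mem_Collect_eq
  by (rule summable_comparison_test[where g = "\<lambda>i. \<bar>x i\<bar> + \<bar>y i\<bar>"])
    (auto intro: summable_add)

lemma ell1_norm_minus_commute: "ell1_norm (x - y) = ell1_norm (y - x)"
  by (simp add: ell1_norm_def abs_minus_commute)

lemma ell1_norm_nonneg: "x \<in> ell1 \<Longrightarrow> 0 \<le> ell1_norm x"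
  by (simp add: ell1_norm_def ell1_def suminf_nonneg)

lemma sum_abs_le_ell1_norm: "x \<in> ell1 \<Longrightarrow> finite A \<Longrightarrow> (\<Sum>i\<in>A. \<bar>x i\<bar>) \<le> ell1_norm x"
  unfolding ell1_norm_def by (rule sum_le_suminf) (auto simp: ell1_def)

lemma summing_norm_le: "(\<And>m. \<bar>\<Sum>i\<le>m. x i\<bar> \<le> B) \<Longrightarrow> summing_norm x \<le> B"
  unfolding summing_norm_def by (rule cSUP_least) auto

section \<open>Separated families between two points\<close>

text \<open>
  If \<open>x\<close> lies nearly between \<open>0\<close> and \<open>w\<close>, then on every finite set the mass of \<open>x\<close> exceeds that
  of \<open>w\<close> by at most the excess in the triangle inequality.
\<close>

lemma sum_abs_near_interval:
  assumes "w \<in> ell1" "x \<in> ell1" "ell1_norm x + ell1_norm (w - x) \<le> ell1_norm w + e" "finite A"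
  shows "(\<Sum>i\<in>A. \<bar>x i\<bar>) \<le> (\<Sum>i\<in>A. \<bar>w i\<bar>) + e"
proof -
  have s: "summable (\<lambda>i. \<bar>x i\<bar>)" "summable (\<lambda>i. \<bar>(w - x) i\<bar>)" "summable (\<lambda>i. \<bar>w i\<bar>)"
    using ell1_diff[OF assms(1,2)] assms by (auto simp: ell1_def)
  let ?e = "\<lambda>i. \<bar>x i\<bar> + \<bar>(w - x) i\<bar> - \<bar>w i\<bar>"
  have "(\<Sum>i\<in>A. \<bar>x i\<bar>) - (\<Sum>i\<in>A. \<bar>w i\<bar>) \<le> (\<Sum>i\<in>A. ?e i)"
    unfolding sum_subtractf[symmetric] by (rule sum_mono) simp
  also have "\<dots> \<le> (\<Sum>i. ?e i)"
    by (rule sum_le_suminf) (use assms(4) summable_diff[OF summable_add[OF s(1,2)] s(3)] in auto)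
  also have "\<dots> = ell1_norm x + ell1_norm (w - x) - ell1_norm w"
    by (simp only: ell1_norm_def suminf_add[OF s(1,2)] suminf_diff[OF summable_add[OF s(1,2)] s(3)])
  finally show ?thesis using assms(3) by linarith
qed

text \<open>
  The indices \<open>m\<close> are put into \<open>N + 1\<close> buckets according to the value of \<open>\<Sum>i\<le>m. \<bar>w i\<bar>\<close>, rounded
  to a multiple of \<open>d / N\<close>. Initial sums of \<open>x i\<close> over indices from the same bucket differ by at
  most \<open>2 * d / N\<close>, so \<open>x i\<close> is determined, up to \<open>5 * d / N\<close> in the summing norm, by its
  initial sums at one representative index per bucket, rounded to multiples of \<open>d / N\<close>.
\<close>

lemma card_separated_near_interval:
  fixes x :: "nat \<Rightarrow> nat \<Rightarrow> real" and d :: real and N k :: nat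
  assumes d: "d > 0" and N: "N \<ge> 1"
    and w: "w \<in> ell1" "ell1_norm w \<le> d"
    and x: "\<And>i. i < k \<Longrightarrow> x i \<in> ell1" "\<And>i. i < k \<Longrightarrow> ell1_norm (x i) \<le> d"
    and between: "\<And>i. i < k \<Longrightarrow> ell1_norm (x i) + ell1_norm (w - x i) \<le> ell1_norm w + d / N"
    and sep: "\<And>i j. i < k \<Longrightarrow> j < k \<Longrightarrow> i \<noteq> j \<Longrightarrow> 5 * d / N < summing_norm (x i - x j)"
  shows "k \<le> (2 * N + 1) ^ (N + 1)"
proof -
  define W where "W m = (\<Sum>i\<le>m. \<bar>w i\<bar>)" for m
  define X where "X i m = (\<Sum>l\<le>m. x i l)" for i m
  define \<delta> where "\<delta> = d / N"
  define b where "b m = nat \<lfloor>W m / \<delta>\<rfloor>" for m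
  \<comment> \<open>A representative of each bucket; the value at an empty bucket is irrelevant.\<close>
  define r where "r c = (SOME m. b m = c)" for c
  define \<sigma> where "\<sigma> i = (\<lambda>c\<in>{..N}. \<lfloor>X i (r c) / \<delta>\<rfloor>)" for i
  have \<delta>: "\<delta> > 0" "d = real N * \<delta>" using d N by (auto simp: \<delta>_def)
  have W: "0 \<le> W m" "W m \<le> d" for m
    using sum_abs_le_ell1_norm[OF w(1), of "{..m}"] w(2) by (auto simp: W_def sum_nonneg)
  have b_le: "b m \<le> N" for m
  proof -
    have "W m / \<delta> \<le> N" using W(2)[of m] \<delta> by (simp add: divide_simps mult.commute)
    then have "\<lfloor>W m / \<delta>\<rfloor> \<le> int N" by linarith
    then show ?thesis by (simp add: b_def)
  qed
  have same_floor: "\<bar>s - t\<bar> \<le> \<delta>" if "\<lfloor>s / \<delta>\<rfloor> = \<lfloor>t / \<delta>\<rfloor>" for s t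
  proof -
    have "\<bar>s / \<delta> - t / \<delta>\<bar> \<le> 1" using that by linarith
    then show ?thesis using \<delta>(1) by (simp add: diff_divide_distrib[symmetric])
  qed
  have X_bucket_ord: "\<bar>X i m' - X i m\<bar> \<le> 2 * \<delta>" if "i < k" "b m = b m'" "m \<le> m'" for i m m'
  proof -
    have split: "{..m'} = {..m} \<union> {m<..m'}" using that(3) by auto
    have "X i m' - X i m = (\<Sum>l\<in>{m<..m'}. x i l)"
      unfolding X_def split by (subst sum.union_disjoint) auto
    then have "\<bar>X i m' - X i m\<bar> \<le> (\<Sum>l\<in>{m<..m'}. \<bar>x i l\<bar>)" by simp
    also have "\<dots> \<le> (\<Sum>l\<in>{m<..m'}. \<bar>w l\<bar>) + \<delta>"
      using sum_abs_near_interval[OF w(1) x(1) between] that(1) by (simp add: \<delta>_def)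
    also have "(\<Sum>l\<in>{m<..m'}. \<bar>w l\<bar>) = W m' - W m"
      unfolding W_def split by (subst sum.union_disjoint) auto
    also have "\<dots> \<le> \<delta>"
    proof -
      have "0 \<le> \<lfloor>W m / \<delta>\<rfloor>" "0 \<le> \<lfloor>W m' / \<delta>\<rfloor>" using W(1) \<delta>(1) by auto
      then have "\<lfloor>W m / \<delta>\<rfloor> = \<lfloor>W m' / \<delta>\<rfloor>" using that(2) unfolding b_def by linarith
      from same_floor[OF this] show ?thesis by linarith
    qed
    finally show ?thesis by simp
  qed
  have X_bucket: "\<bar>X i m' - X i m\<bar> \<le> 2 * \<delta>" if "i < k" "b m = b m'" for i m m'
    using X_bucket_ord[OF that] X_bucket_ord[OF that(1) that(2)[symmetric]]
    by (cases "m \<le> m'") (auto simp: abs_minus_commute)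
  have "inj_on \<sigma> {..<k}"
  proof (rule inj_onI, rule ccontr)
    fix i j assume ij: "i \<in> {..<k}" "j \<in> {..<k}" "\<sigma> i = \<sigma> j" "i \<noteq> j"
    have "\<bar>\<Sum>l\<le>m. (x i - x j) l\<bar> \<le> 5 * \<delta>" for m
    proof -
      have rb: "b (r (b m)) = b m" unfolding r_def by (rule someI) (rule refl)
      have "\<lfloor>X i (r (b m)) / \<delta>\<rfloor> = \<lfloor>X j (r (b m)) / \<delta>\<rfloor>"
        using fun_cong[OF ij(3), of "b m"] b_le[of m] by (simp add: \<sigma>_def)
      \<comment> \<open>Two steps of \<open>2 * \<delta>\<close> to and from the representative, and \<open>\<delta>\<close> for the rounding there.\<close>
      from same_floor[OF this] X_bucket[of i, OF _ rb] X_bucket[of j, OF _ rb] ij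
      have "\<bar>X i m - X j m\<bar> \<le> 5 * \<delta>" by fastforce
      then show ?thesis by (simp add: X_def sum_subtractf)
    qed
    then have "summing_norm (x i - x j) \<le> 5 * \<delta>" by (rule summing_norm_le)
    with sep[of i j] ij show False by (simp add: \<delta>_def)
  qed
  moreover have "\<sigma> i \<in> {..N} \<rightarrow>\<^sub>E {- int N..int N}" if "i < k" for i
  proof -
    have "\<lfloor>X i m / \<delta>\<rfloor> \<in> {- int N..int N}" for m
    proof -
      have "\<bar>X i m\<bar> \<le> (\<Sum>l\<le>m. \<bar>x i l\<bar>)" by (simp add: X_def)
      also have "\<dots> \<le> d" using sum_abs_le_ell1_norm[OF x(1)] x(2) that
        by (meson finite_atMost order_trans)
      finally have "\<bar>X i m / \<delta>\<bar> \<le> N" using \<delta> by (simp add: abs_divide divide_simps mult.commute)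
      then show ?thesis by (simp only: abs_le_iff atLeastAtMost_iff le_floor_iff floor_le_iff) simp
    qed
    then show ?thesis by (auto simp: \<sigma>_def)
  qed
  ultimately have "card {..<k} \<le> card ({..N} \<rightarrow>\<^sub>E {- int N..int N})"
    by (intro card_inj_on_le[of \<sigma>]) (auto intro!: finite_PiE)
  also have "\<dots> = (2 * N + 1) ^ (N + 1)"
  proof -
    have "card {- int N..int N} = 2 * N + 1" by simp
    then show ?thesis
      by (simp only: card_PiE[OF finite_atMost] prod_constant card_atMost Suc_eq_plus1)
  qed
  finally show ?thesis by simp
qed

section \<open>Distances in diamond graphs\<close>

lemma diamond_pverts_mono: "m \<le> n \<Longrightarrow> pverts (diamond k m) \<subseteq> pverts (diamond k n)"
  unfolding pverts_diamond by (rule lift_Suc_mono_le) auto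

lemma diamond_oriented_arcE:
  assumes "(u, v) \<in> parcs (diamond_oriented k m)"
  shows "u \<in> pverts (diamond k m)" "v \<in> pverts (diamond k m)" "u \<noteq> v"
  using assms diamond_oriented_wf[of k m] by (auto simp: pverts_diamond)

text \<open>An edge of level \<open>m\<close> is refined, \<open>q\<close> levels later, to a path of \<open>2 ^ q\<close> edges.\<close>

lemma diamond_edge_walk:
  assumes "k \<ge> 1" "(u, v) \<in> parcs (diamond_oriented k m)"
  shows "\<exists>p. pre_digraph.awalk (with_proj (diamond k (m + q))) u p v \<and> length p = 2 ^ q"
  using assms(2)
proof (induction q arbitrary: m u v)
  case 0
  interpret D: pair_graph "diamond k m" by (rule pair_graph_diamond)
  have "(u, v) \<in> parcs (diamond k m)" using 0 by (simp add: parcs_diamond)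
  moreover have "v \<in> pverts (diamond k m)"
    using 0 diamond_oriented_wf[of k m] by (auto simp: pverts_diamond)
  ultimately have "D.awalk u [(u, v)] v" by (simp add: D.awalk_Cons_iff D.awalk_Nil_iff)
  then show ?case by (intro exI[of _ "[(u, v)]"]) simp
next
  case (Suc q)
  interpret D: pair_graph "diamond k (Suc m + q)" by (rule pair_graph_diamond)
  have "(u, Mid u v 0) \<in> parcs (diamond_oriented k (Suc m))"
    "(Mid u v 0, v) \<in> parcs (diamond_oriented k (Suc m))"
    using Suc.prems assms(1) by force+
  from Suc.IH[OF this(1)] Suc.IH[OF this(2)] obtain p p' where
    "D.awalk u p (Mid u v 0)" "length p = 2 ^ q" "D.awalk (Mid u v 0) p' v" "length p' = 2 ^ q"
    by auto
  moreover from this have "D.awalk u (p @ p') v" by (blast intro: D.awalk_appendI)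
  ultimately show ?case by (intro exI[of _ "p @ p'"]) simp
qed

lemma diamond_dist_edge_le:
  assumes "k \<ge> 1" "(u, v) \<in> parcs (diamond_oriented k m)" "m \<le> n"
  shows "diamond_dist k n u v \<le> (1 / 2) ^ m"
proof -
  interpret D: pair_graph "diamond k n" by (rule pair_graph_diamond)
  obtain p where p: "D.awalk u p v" "length p = 2 ^ (n - m)"
    using diamond_edge_walk[OF assms(1,2), of "n - m"] assms(3) by auto
  have "D.awalk_cost (\<lambda>_. (1 / 2) ^ n) p = (1 / 2 :: real) ^ m"
  proof -
    have "D.awalk_cost (\<lambda>_. (1 / 2) ^ n) p = 2 ^ (n - m) * (1 / 2 :: real) ^ n"
      using p(2) by (simp add: D.awalk_cost_def sum_list_triv)
    also have "\<dots> = 2 ^ (n - m) * ((1 / 2) ^ (n - m) * (1 / 2) ^ m)"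
      using assms(3) by (simp flip: power_add)
    also have "\<dots> = (1 / 2) ^ m" by (simp add: power_divide)
    finally show ?thesis .
  qed
  then have "D.\<mu> (\<lambda>_. (1 / 2) ^ n) u v \<le> ereal ((1 / 2) ^ m)"
    using D.min_cost_le_walk_cost[OF p(1), of "\<lambda>_. (1 / 2) ^ n"] by simp
  then show ?thesis
    unfolding diamond_dist_def by (cases "D.\<mu> (\<lambda>_. (1 / 2) ^ n) u v") auto
qed

text \<open>
  Distances are bounded from below by the variation of a function that is Lipschitz along edges.
\<close>

lemma diamond_dist_ge_Lipschitz:
  fixes h :: "dvertex \<Rightarrow> real"
  assumes "k \<ge> 1" and uv: "u \<in> pverts (diamond k n)" "v \<in> pverts (diamond k n)"
    and h: "\<And>a b. (a, b) \<in> parcs (diamond_oriented k n) \<Longrightarrow> \<bar>h a - h b\<bar> \<le> (1 / 2) ^ n"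
  shows "\<bar>h u - h v\<bar> \<le> diamond_dist k n u v"
proof -
  interpret D: pair_graph "diamond k n" by (rule pair_graph_diamond)
  have walk: "\<bar>h a - h b\<bar> \<le> D.awalk_cost (\<lambda>_. (1 / 2) ^ n) p" if "D.awalk a p b" for a b p
    using that
  proof (induction p arbitrary: a)
    case Nil
    then show ?case by (simp add: D.awalk_Nil_iff)
  next
    case (Cons e p)
    obtain c where e: "e = (a, c)" "(a, c) \<in> parcs (diamond k n)" "D.awalk c p b"
      using Cons.prems by (cases e) (auto simp: D.awalk_Cons_iff)
    have "\<bar>h a - h c\<bar> \<le> (1 / 2) ^ n"
      using e(2) h[of a c] h[of c a] by (auto simp: parcs_diamond abs_minus_commute)
    with Cons.IH[OF e(3)] show ?case by simp
  qed
  have "ereal \<bar>h u - h v\<bar> \<le> D.\<mu> (\<lambda>_. (1 / 2) ^ n) u v"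
    unfolding D.\<mu>_def by (rule INF_greatest) (use walk in auto)
  moreover have "\<bar>D.\<mu> (\<lambda>_. (1 / 2) ^ n) u v\<bar> \<noteq> \<infinity>"
    by (rule diamond_mu_finite[OF assms(1) uv])
  ultimately show ?thesis
    unfolding diamond_dist_def by (cases "D.\<mu> (\<lambda>_. (1 / 2) ^ n) u v") auto
qed

text \<open>
  The function that takes the values \<open>s\<close> and \<open>- s\<close> at the midpoints number \<open>i\<close> and \<open>j\<close> of the
  edge \<open>u v\<close>, vanishes at all other vertices of the level at which these midpoints appear, and is
  extended to the later levels by averaging.
\<close>

primrec separator :: "dvertex \<Rightarrow> dvertex \<Rightarrow> nat \<Rightarrow> nat \<Rightarrow> real \<Rightarrow> dvertex \<Rightarrow> real" where
  "separator u v i j s Src = 0"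
| "separator u v i j s Tgt = 0"
| "separator u v i j s (Mid a b l) =
    (if a = u \<and> b = v then (if l = i then s else if l = j then - s else 0)
     else (separator u v i j s a + separator u v i j s b) / 2)"

lemma diamond_oriented_level_unique:
  "(u, v) \<in> parcs (diamond_oriented k m) \<Longrightarrow> (u, v) \<in> parcs (diamond_oriented k n) \<Longrightarrow> m = n"
  using depth_pverts_diamond_oriented[of k m] depth_pverts_diamond_oriented[of k n] by fastforce

lemma diamond_oriented_Suc_arcE:
  assumes "(a, b) \<in> parcs (diamond_oriented k (Suc p))"
  obtains a' b' l where "(a', b') \<in> parcs (diamond_oriented k p)"
    "(a, b) = (a', Mid a' b' l) \<or> (a, b) = (Mid a' b' l, b')"
  using assms by auto

lemma separator_eq_0:
  assumes uv: "(u, v) \<in> parcs (diamond_oriented k m)" and "p \<le> m"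
    and "a \<in> pverts (diamond_oriented k p)"
  shows "separator u v i j s a = 0"
  using assms(2,3)
proof (induction p arbitrary: a)
  case (Suc p)
  have "(u, v) \<notin> parcs (diamond_oriented k p)"
    using diamond_oriented_level_unique[OF uv] Suc.prems(1) by auto
  with Suc show ?case
    using diamond_oriented_wf[of k p] by fastforce
qed auto

lemma separator_Lipschitz:
  assumes uv: "(u, v) \<in> parcs (diamond_oriented k m)" and "s \<ge> 0"
    and "(a, b) \<in> parcs (diamond_oriented k (Suc m + q))"
  shows "\<bar>separator u v i j s a - separator u v i j s b\<bar> \<le> s / 2 ^ q"
  using assms(3)
proof (induction q arbitrary: a b)
  case 0
  then obtain a' b' l where ab: "(a', b') \<in> parcs (diamond_oriented k m)"
    "(a, b) = (a', Mid a' b' l) \<or> (a, b) = (Mid a' b' l, b')"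
    by (metis add_0_right diamond_oriented_Suc_arcE)
  have "separator u v i j s a' = 0" "separator u v i j s b' = 0"
    using separator_eq_0[OF uv order_refl] diamond_oriented_wf[of k m] ab(1) by auto
  with ab(2) \<open>s \<ge> 0\<close> show ?case by auto
next
  case (Suc q)
  then obtain a' b' l where ab: "(a', b') \<in> parcs (diamond_oriented k (Suc m + q))"
    "(a, b) = (a', Mid a' b' l) \<or> (a, b) = (Mid a' b' l, b')"
    by (metis add_Suc_right diamond_oriented_Suc_arcE)
  have "\<not> (a' = u \<and> b' = v)"
    using diamond_oriented_level_unique[OF uv, of "Suc m + q"] ab(1) by auto
  then have "separator u v i j s (Mid a' b' l) =
      (separator u v i j s a' + separator u v i j s b') / 2"
    by (simp only: separator.simps if_False)
  then have "\<bar>separator u v i j s a - separator u v i j s b\<bar> =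
      \<bar>separator u v i j s a' - separator u v i j s b'\<bar> / 2"
    using ab(2) by (auto simp: abs_if field_simps simp del: separator.simps)
  also have "\<dots> \<le> s / 2 ^ Suc q" using Suc.IH[OF ab(1)] by simp
  finally show ?case .
qed

lemma diamond_dist_Mid_ge:
  assumes "k \<ge> 1" and uv: "(u, v) \<in> parcs (diamond_oriented k m)" and "m < n"
    and ij: "i < k" "j < k" "i \<noteq> j"
  shows "(1 / 2) ^ m \<le> diamond_dist k n (Mid u v i) (Mid u v j)"
proof -
  let ?s = "(1 / 2 :: real) ^ Suc m"
  have "Mid u v l \<in> pverts (diamond k (Suc m))" if "l < k" for l
    using uv that by (force simp: pverts_diamond)
  then have mids: "Mid u v i \<in> pverts (diamond k n)" "Mid u v j \<in> pverts (diamond k n)"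
    using ij diamond_pverts_mono[of "Suc m" n k] \<open>m < n\<close> by auto
  have "\<bar>separator u v i j ?s a - separator u v i j ?s b\<bar> \<le> (1 / 2) ^ n"
    if "(a, b) \<in> parcs (diamond_oriented k n)" for a b
  proof -
    have n: "n = Suc m + (n - Suc m)" using \<open>m < n\<close> by simp
    then have "\<bar>separator u v i j ?s a - separator u v i j ?s b\<bar> \<le> ?s / 2 ^ (n - Suc m)"
      using separator_Lipschitz[OF uv, of ?s a b "n - Suc m"] that by simp
    also have "\<dots> = (1 / 2) ^ (Suc m + (n - Suc m))"
      by (simp only: power_add power_divide) simp
    finally show ?thesis using n by simp
  qed
  from diamond_dist_ge_Lipschitz[OF assms(1) mids, where h = "separator u v i j ?s", OF this]
  show ?thesis using ij(3) by simp
qed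

section \<open>The edge of maximal stretch\<close>

lemma exists_small_increment:
  fixes \<alpha> :: "nat \<Rightarrow> real"
  assumes "n \<ge> 1" "0 \<le> \<alpha> 0" "\<alpha> n \<le> 1"
  shows "\<exists>m<n. \<alpha> (Suc m) - \<alpha> m \<le> 1 / n"
proof (rule ccontr)
  assume "\<not> ?thesis"
  then have "(\<Sum>m<n. 1 / n) < (\<Sum>m<n. \<alpha> (Suc m) - \<alpha> m)"
    using assms(1) by (intro sum_strict_mono) (auto simp: not_le lessThan_empty_iff)
  then show False using assms by (simp add: sum_lessThan_telescope)
qed

text \<open>
  For a given constant \<open>C\<close>, a single level \<open>n \<ge> 5 * C\<close> already bounds the branching. On the edge
  \<open>u v\<close> chosen below, of length \<open>d\<close>, the excess of \<open>ell1_norm (x\<^sub>i) + ell1_norm (w - x\<^sub>i)\<close> over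
  \<open>ell1_norm w\<close> is at most \<open>d / n\<close>, and \<open>d / C \<ge> 5 * d / n\<close> is the separation required by
  \<open>card_separated_near_interval\<close>.
\<close>

lemma diamond_branching_bound:
  fixes f :: "dvertex \<Rightarrow> nat \<Rightarrow> real" and C :: real
  assumes C: "C > 0" and n: "n \<ge> 1" "5 * C \<le> n" and k: "k \<ge> 1"
    and f: "f ` pverts (diamond k n) \<subseteq> ell1"
    and upper: "\<And>u v. u \<in> pverts (diamond k n) \<Longrightarrow> v \<in> pverts (diamond k n) \<Longrightarrow> u \<noteq> v \<Longrightarrow>
      ell1_norm (f u - f v) \<le> diamond_dist k n u v"
    and lower: "\<And>u v. u \<in> pverts (diamond k n) \<Longrightarrow> v \<in> pverts (diamond k n) \<Longrightarrow> u \<noteq> v \<Longrightarrow>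
      diamond_dist k n u v < C * summing_norm (f u - f v)"
  shows "k \<le> (2 * n + 1) ^ (n + 1)"
proof -
  define E where "E m = parcs (diamond_oriented k m)" for m
  \<comment> \<open>The largest stretch on level \<open>m\<close>, where the edges have length \<open>(1 / 2) ^ m\<close>.\<close>
  define \<alpha> where "\<alpha> m = (MAX (a, b)\<in>E m. 2 ^ m * ell1_norm (f b - f a))" for m
  have verts: "a \<in> pverts (diamond k n)" "b \<in> pverts (diamond k n)" "a \<noteq> b"
    if "(a, b) \<in> E m" "m \<le> n" for a b m
    using diamond_oriented_arcE[of a b k m] diamond_pverts_mono[OF that(2), of k] that(1)
    by (auto simp: E_def)
  have f_ell1: "f a \<in> ell1" if "a \<in> pverts (diamond k n)" for a using f that by blast
  have fin: "finite (E m)" for m using diamond_oriented_finite by (simp add: E_def)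
  have ne: "E m \<noteq> {}" for m
  proof (induction m)
    case (Suc m)
    then obtain a b where "(a, b) \<in> E m" by auto
    then have "(a, Mid a b 0) \<in> E (Suc m)" using k by (force simp: E_def)
    then show ?case by blast
  qed (simp add: E_def)
  have edge: "ell1_norm (f b - f a) \<le> (1 / 2) ^ m" if "(a, b) \<in> E m" "m \<le> n" for a b m
    using upper[OF verts(1,2,3)[OF that]] diamond_dist_edge_le[OF k, of a b m n] that
      ell1_norm_minus_commute[of "f a" "f b"]
    by (simp add: E_def)
  have \<alpha>_ge: "2 ^ m * ell1_norm (f b - f a) \<le> \<alpha> m" if "(a, b) \<in> E m" for a b m
    unfolding \<alpha>_def using that fin by (intro Max_ge) force+
  have \<alpha>_attained: "\<exists>(a, b)\<in>E m. \<alpha> m = 2 ^ m * ell1_norm (f b - f a)" for m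
  proof -
    have "\<alpha> m \<in> (\<lambda>(a, b). 2 ^ m * ell1_norm (f b - f a)) ` E m"
      unfolding \<alpha>_def using fin ne by (intro Max_in) auto
    then show ?thesis by auto
  qed
  have "0 \<le> \<alpha> 0"
  proof -
    obtain a b where ab: "(a, b) \<in> E 0" using ne[of 0] by auto
    have "0 \<le> ell1_norm (f b - f a)"
      using verts[OF ab] f_ell1 by (intro ell1_norm_nonneg ell1_diff) auto
    with \<alpha>_ge[OF ab] show ?thesis by simp
  qed
  moreover have "\<alpha> n \<le> 1"
  proof -
    obtain a b where ab: "(a, b) \<in> E n" "\<alpha> n = 2 ^ n * ell1_norm (f b - f a)"
      using \<alpha>_attained[of n] by blast
    have "\<alpha> n \<le> 2 ^ n * (1 / 2) ^ n"
      unfolding ab(2) using edge[OF ab(1)] by (intro mult_left_mono) auto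
    then show ?thesis by (simp add: power_divide)
  qed
  ultimately obtain m where m: "m < n" "\<alpha> (Suc m) - \<alpha> m \<le> 1 / n"
    using exists_small_increment[OF n(1), of \<alpha>] by blast
  obtain u v where uv: "(u, v) \<in> E m" "\<alpha> m = 2 ^ m * ell1_norm (f v - f u)"
    using \<alpha>_attained[of m] by blast
  define d where "d = (1 / 2 :: real) ^ m"
  have d: "d > 0" "2 ^ m * d = 1" by (auto simp: d_def power_divide)
  have halves: "(u, Mid u v i) \<in> E (Suc m)" "(Mid u v i, v) \<in> E (Suc m)" if "i < k" for i
    using uv(1) that by (force simp: E_def)+
  have mid: "Mid u v i \<in> pverts (diamond k n)" if "i < k" for i
    using verts(2)[OF halves(1)[OF that]] m(1) by simp
  note u = verts(1)[OF uv(1) less_imp_le[OF m(1)]] and v = verts(2)[OF uv(1) less_imp_le[OF m(1)]]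
  show ?thesis
  proof (rule card_separated_near_interval[where w = "f v - f u" and d = d
        and x = "\<lambda>i. f (Mid u v i) - f u"])
    show "d > 0" "n \<ge> 1" by (fact d n)+
    show "f v - f u \<in> ell1" using u v f_ell1 ell1_diff by blast
    show "ell1_norm (f v - f u) \<le> d" using edge[OF uv(1)] m(1) by (simp add: d_def)
    fix i assume i: "i < k"
    show "f (Mid u v i) - f u \<in> ell1" using mid[OF i] u f_ell1 ell1_diff by blast
    have "ell1_norm (f (Mid u v i) - f u) \<le> (1 / 2) ^ Suc m"
      using edge[OF halves(1)[OF i]] m(1) by simp
    also have "\<dots> \<le> d" by (simp add: d_def)
    finally show "ell1_norm (f (Mid u v i) - f u) \<le> d" .
    have "2 ^ Suc m * ell1_norm (f (Mid u v i) - f u) \<le> \<alpha> (Suc m)"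
      "2 ^ Suc m * ell1_norm (f v - f (Mid u v i)) \<le> \<alpha> (Suc m)"
      using \<alpha>_ge halves[OF i] by blast+
    then have "2 ^ m * (ell1_norm (f (Mid u v i) - f u) + ell1_norm (f v - f (Mid u v i)))
        \<le> \<alpha> (Suc m)"
      by (simp add: algebra_simps)
    also have "\<dots> \<le> \<alpha> m + 1 / n" using m(2) by simp
    also have "\<dots> = 2 ^ m * (ell1_norm (f v - f u) + d / n)"
      using d(2) uv(2) by (simp add: algebra_simps)
    finally have "ell1_norm (f (Mid u v i) - f u) + ell1_norm (f v - f (Mid u v i))
        \<le> ell1_norm (f v - f u) + d / n"
      by simp
    moreover have "f v - f u - (f (Mid u v i) - f u) = f v - f (Mid u v i)" by (rule ext) simp
    ultimately show "ell1_norm (f (Mid u v i) - f u) + ell1_norm (f v - f u - (f (Mid u v i) - f u))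
        \<le> ell1_norm (f v - f u) + d / n"
      by simp
    fix j assume j: "j < k" "i \<noteq> j"
    have "d \<le> diamond_dist k n (Mid u v i) (Mid u v j)"
      unfolding d_def using diamond_dist_Mid_ge[OF k _ m(1) i j] uv(1) by (simp add: E_def)
    also have "\<dots> < C * summing_norm (f (Mid u v i) - f (Mid u v j))"
      using lower mid i j by simp
    finally have "d / C < summing_norm (f (Mid u v i) - f (Mid u v j))"
      using C by (simp add: divide_simps mult.commute)
    moreover have "5 * d / n \<le> d / C"
      using mult_left_mono[OF n(2), of d] d(1) n(1) C by (simp add: divide_simps ac_simps)
    moreover have "f (Mid u v i) - f u - (f (Mid u v j) - f u) = f (Mid u v i) - f (Mid u v j)"
      by (rule ext) simp
    ultimately show "5 * d / n < summing_norm (f (Mid u v i) - f u - (f (Mid u v j) - f u))"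
      by simp
  qed
qed

theorem theorem1p6:
  fixes C :: real
  assumes "C > 1"
  shows "\<exists>K::nat. \<forall>k\<ge>2.
    (\<forall>n\<ge>1. \<exists>f :: dvertex \<Rightarrow> nat \<Rightarrow> real.
       f ` pverts (diamond k n) \<subseteq> ell1 \<and>
       inj_on f (pverts (diamond k n)) \<and>
       (\<forall>u\<in>pverts (diamond k n). \<forall>v\<in>pverts (diamond k n). u \<noteq> v \<longrightarrow>
          ell1_norm (f u - f v) \<le> diamond_dist k n u v \<and>
          diamond_dist k n u v < C * summing_norm (f u - f v)))
    \<longrightarrow> k \<le> K"
proof -
  obtain n :: nat where n: "5 * C \<le> n" using real_arch_simple by blast
  then have n1: "n \<ge> 1" using assms by linarith
  show ?thesis
  proof (intro exI[of _ "(2 * n + 1) ^ (n + 1)"] allI impI)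
    fix k :: nat
    assume k: "k \<ge> 2" and "\<forall>n\<ge>1. \<exists>f :: dvertex \<Rightarrow> nat \<Rightarrow> real.
       f ` pverts (diamond k n) \<subseteq> ell1 \<and>
       inj_on f (pverts (diamond k n)) \<and>
       (\<forall>u\<in>pverts (diamond k n). \<forall>v\<in>pverts (diamond k n). u \<noteq> v \<longrightarrow>
          ell1_norm (f u - f v) \<le> diamond_dist k n u v \<and>
          diamond_dist k n u v < C * summing_norm (f u - f v))"
    with n1 obtain f :: "dvertex \<Rightarrow> nat \<Rightarrow> real" where
      "f ` pverts (diamond k n) \<subseteq> ell1"
      "\<forall>u\<in>pverts (diamond k n). \<forall>v\<in>pverts (diamond k n). u \<noteq> v \<longrightarrow>
          ell1_norm (f u - f v) \<le> diamond_dist k n u v \<and>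
          diamond_dist k n u v < C * summing_norm (f u - f v)"
      by meson
    then show "k \<le> (2 * n + 1) ^ (n + 1)"
      using k n n1 assms by (intro diamond_branching_bound[of C n k f]) auto
  qed
qed

end
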